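(* Let $\mathcal H$ be a real Hilbert space, let $\mu\in\,]0,\infty[$, let $n\ge 1$ be an integer, $I=\{1,\dots,n\}$, and let $\lambda_i>0$ ($i\in I$) satisfy $\sum_{i\in I}\lambda_i=1$. Suppose that for each $i\in I$, $f_i:\mathcal H\to\,]-\infty,+\infty]$ is proper, lower semicontinuous and convex, and that there exists $i_0\in I$ such that $f_{i_0}$ is uniformly smooth. Write $\mathbf f=(f_1,\dots,f_n)$, $\boldsymbol\lambda=(\lambda_1,\dots,\lambda_n)$. Then the proximal average $p_\mu(\mathbf f,\boldsymbol\lambda)$ is uniformly smooth.
   Context: A proper and convex function $f:\mathcal H\to\,]-\infty,+\infty]$ is uniformly smooth if there exists a function $\psi:[0,\infty[\,\to[0,\infty]$ with $\lim_{t\to0}\psi(t)/t=0$ such that for all $x,y\in\mathcal H$ and every $\lambda\in\,]0,1[$ with $(1-\lambda)x+\lambda y\in\operatorname{dom}f=\{f<\infty\}$, $$f\big((1-\lambda)x+\lambda y\big)+\lambda(1-\lambda)\psi(\|x-y\|)\ge(1-\lambda)f(x)+\lambda f(y).$$ The $\boldsymbol\lambda$-weighted proximal average of $\mathbf f$ with parameter $\mu$ is the function $$p_\mu(\mathbf f,\boldsymbol\lambda)(x)=\frac1\mu\Big(-\frac12\|x\|^2+\inf_{\sum_{i\in I}x_i=x}\sum_{i\in I}\lambda_i\big(\mu f_i(x_i/\lambda_i)+\tfrac12\|x_i/\lambda_i\|^2\big)\Big),\quad x\in\mathcal H.$$ *)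

theory Defs
  imports "HOL-Analysis.Analysis"
begin

text \<open>
  Functions from a Hilbert space to \<open>]-\<infinity>,+\<infinity>]\<close> are rendered as \<open>ereal\<close>-valued functions; the value
  \<open>-\<infinity>\<close> is excluded by properness.
\<close>

definition proper_fun :: "('a \<Rightarrow> ereal) \<Rightarrow> bool" where
  "proper_fun f \<longleftrightarrow> (\<forall>x. f x \<noteq> -\<infinity>) \<and> (\<exists>x. f x < \<infinity>)"

definition convex_fun :: "('a::real_vector \<Rightarrow> ereal) \<Rightarrow> bool" where
  "convex_fun f \<longleftrightarrow>
     (\<forall>x y. \<forall>l\<in>{0<..<1::real}.
        f ((1 - l) *\<^sub>R x + l *\<^sub>R y) \<le> ereal (1 - l) * f x + ereal l * f y)"

definition lsc_fun :: "('a::topological_space \<Rightarrow> ereal) \<Rightarrow> bool" where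
  "lsc_fun f \<longleftrightarrow> (\<forall>x a. a < f x \<longrightarrow> (\<forall>\<^sub>F y in nhds x. a < f y))"

text \<open>
  The modulus \<open>\<psi>\<close> maps \<open>[0,\<infinity>[\<close> to \<open>[0,\<infinity>]\<close>; its values at negative reals are irrelevant.
\<close>

definition uniformly_smooth :: "('a::real_normed_vector \<Rightarrow> ereal) \<Rightarrow> bool" where
  "uniformly_smooth f \<longleftrightarrow>
     proper_fun f \<and> convex_fun f \<and>
     (\<exists>\<psi> :: real \<Rightarrow> ereal.
        (\<forall>t\<ge>0. 0 \<le> \<psi> t) \<and>
        ((\<lambda>t. \<psi> t / ereal t) \<longlongrightarrow> 0) (at_right 0) \<and>
        (\<forall>x y. \<forall>l\<in>{0<..<1::real}.
           f ((1 - l) *\<^sub>R x + l *\<^sub>R y) < \<infinity> \<longrightarrow>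
           f ((1 - l) *\<^sub>R x + l *\<^sub>R y) + ereal (l * (1 - l)) * \<psi> (norm (x - y))
             \<ge> ereal (1 - l) * f x + ereal l * f y))"

text \<open>
  The decompositions \<open>u\<close> are total functions on the index type, but only their values on \<open>I\<close> enter.
\<close>

definition prox_average ::
    "'i set \<Rightarrow> real \<Rightarrow> ('i \<Rightarrow> 'a::real_inner \<Rightarrow> ereal) \<Rightarrow> ('i \<Rightarrow> real) \<Rightarrow> 'a \<Rightarrow> ereal" where
  "prox_average I \<mu> f lam x =
     ereal (1 / \<mu>) *
       (- ereal (1/2 * (norm x)\<^sup>2) +
        (INF u \<in> {u. (\<Sum>i\<in>I. u i) = x}.
           \<Sum>i\<in>I. ereal (lam i) *
             (ereal \<mu> * f i (u i /\<^sub>R lam i) + ereal (1/2 * (norm (u i /\<^sub>R lam i))\<^sup>2))))"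

end

theory Submission
  imports Defs
begin

text \<open>
  For a decomposition \<open>x = \<Sum>u\<^sub>i\<close> put \<open>x\<^sub>i = u\<^sub>i / \<lambda>\<^sub>i\<close>. The proximal average at \<open>x\<close> is the infimum of
  \<open>\<Sum>\<lambda>\<^sub>i f\<^sub>i(x\<^sub>i) + V(x\<^sub>1,\<dots>,x\<^sub>n) / (2\<mu>)\<close> over all families with \<open>\<Sum>\<lambda>\<^sub>i x\<^sub>i = x\<close>, where
  \<open>V(x\<^sub>1,\<dots>,x\<^sub>n) = \<Sum>\<lambda>\<^sub>i \<parallel>x\<^sub>i\<parallel>\<^sup>2 - \<parallel>\<Sum>\<lambda>\<^sub>i x\<^sub>i\<parallel>\<^sup>2\<close> is the weighted variance, a quadratic form
  that is nonnegative because the weights are positive and sum to one. Lemma \<open>prox_average_less_iff\<close> states this as a description of the strict epigraph in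
  which all quantities are real, so that arithmetic with infinite values is avoided.

  The average is convex as the marginal of a jointly convex function. It never takes the value
  \<open>-\<infinity>\<close>, because a proper lower semicontinuous convex function decreases at most linearly
  (\<open>proper_lsc_convex_lower_bound\<close>) and \<open>V(x\<^sub>1,\<dots>,x\<^sub>n) = \<Sum>\<lambda>\<^sub>i \<parallel>x\<^sub>i - x\<parallel>\<^sup>2\<close> grows quadratically.

  For smoothness let \<open>z = (1 - l)x + ly\<close>, let \<open>f\<^sub>k\<close> be uniformly smooth with modulus \<open>\<psi>\<close>, and take a
  nearly optimal family \<open>(z\<^sub>i)\<close> for \<open>z\<close>. Changing only its \<open>k\<close>-th member, to \<open>z\<^sub>k + (x - z) / \<lambda>\<^sub>k\<close> or to
  \<open>z\<^sub>k + (y - z) / \<lambda>\<^sub>k\<close>, gives families admissible for \<open>x\<close> and for \<open>y\<close>, whose convex combination is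
  \<open>(z\<^sub>i)\<close> again. The two new members are at distance \<open>\<parallel>x - y\<parallel> / \<lambda>\<^sub>k\<close>. Smoothness of \<open>f\<^sub>k\<close> controls the
  change of the \<open>k\<close>-th term, and the quadratic identity \<open>weighted_variance_convex_combination\<close> gives
  the change of \<open>V\<close> exactly. Hence (\<open>prox_average_smoothness_inequality\<close>) the average has the modulus
  \<open>t \<mapsto> \<lambda>\<^sub>k \<psi>(t / \<lambda>\<^sub>k) + (1 / \<lambda>\<^sub>k - 1) t\<^sup>2 / (2\<mu>)\<close>, which is \<open>o(t)\<close> at \<open>0\<close>.
\<close>

section \<open>The weighted variance\<close>

text \<open>
  For weights of sum one this is the variance of the family \<open>v\<close> about its weighted mean; it is
  defined in the form in which it appears in the proximal average.
\<close>

definition weighted_variance :: "'i set \<Rightarrow> ('i \<Rightarrow> real) \<Rightarrow> ('i \<Rightarrow> 'a::real_inner) \<Rightarrow> real" where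
  "weighted_variance I lam v = (\<Sum>i\<in>I. lam i * (norm (v i))\<^sup>2) - (norm (\<Sum>i\<in>I. lam i *\<^sub>R v i))\<^sup>2"

lemma weighted_variance_eq_sum_dist:
  assumes "(\<Sum>i\<in>I. lam i) = 1"
  shows "weighted_variance I lam v
     = (\<Sum>i\<in>I. lam i * (norm (v i - (\<Sum>j\<in>I. lam j *\<^sub>R v j)))\<^sup>2)"
proof -
  define m where "m = (\<Sum>j\<in>I. lam j *\<^sub>R v j)"
  have mm: "(\<Sum>i\<in>I. lam i * inner (v i) m) = inner m m"
    by (simp add: m_def inner_sum_left)
  have "(\<Sum>i\<in>I. lam i * (norm (v i - m))\<^sup>2)
     = (\<Sum>i\<in>I. lam i * (norm (v i))\<^sup>2 - 2 * (lam i * inner (v i) m) + lam i * inner m m)"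
    by (rule sum.cong)
       (simp_all add: power2_norm_eq_inner inner_diff_left inner_diff_right inner_commute algebra_simps)
  also have "\<dots> = (\<Sum>i\<in>I. lam i * (norm (v i))\<^sup>2) - 2 * (\<Sum>i\<in>I. lam i * inner (v i) m)
      + (\<Sum>i\<in>I. lam i) * inner m m"
    by (simp add: sum.distrib sum_subtractf sum_distrib_left sum_distrib_right)
  also have "\<dots> = weighted_variance I lam v"
    unfolding mm assms weighted_variance_def m_def[symmetric] by (simp add: power2_norm_eq_inner)
  finally show ?thesis by (simp add: m_def)
qed

lemma weighted_variance_nonneg:
  assumes "(\<Sum>i\<in>I. lam i) = 1" "\<And>i. i \<in> I \<Longrightarrow> lam i > 0"
  shows "0 \<le> weighted_variance I lam v"
  unfolding weighted_variance_eq_sum_dist[OF assms(1)]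
  by (intro sum_nonneg mult_nonneg_nonneg) (auto simp: assms(2) less_imp_le)

lemma norm_convex_combination_sq:
  fixes x y :: "'a::real_inner"
  shows "(norm ((1 - l) *\<^sub>R x + l *\<^sub>R y))\<^sup>2
    = (1 - l) * (norm x)\<^sup>2 + l * (norm y)\<^sup>2 - l * (1 - l) * (norm (x - y))\<^sup>2"
  by (simp add: power2_norm_eq_inner inner_add_left inner_add_right inner_diff_left
      inner_diff_right inner_commute algebra_simps)

lemma sum_scaleR_convex_combination:
  fixes v w :: "'i \<Rightarrow> 'a::real_vector"
  shows "(\<Sum>i\<in>I. lam i *\<^sub>R ((1 - l) *\<^sub>R v i + l *\<^sub>R w i))
    = (1 - l) *\<^sub>R (\<Sum>i\<in>I. lam i *\<^sub>R v i) + l *\<^sub>R (\<Sum>i\<in>I. lam i *\<^sub>R w i)"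
  by (simp add: scaleR_right_distrib sum.distrib scaleR_sum_right mult.commute)

lemma weighted_variance_convex_combination:
  "weighted_variance I lam (\<lambda>i. (1 - l) *\<^sub>R v i + l *\<^sub>R w i)
    = (1 - l) * weighted_variance I lam v + l * weighted_variance I lam w
      - l * (1 - l) * weighted_variance I lam (\<lambda>i. v i - w i)"
proof -
  have 1: "(\<Sum>i\<in>I. lam i *\<^sub>R (v i - w i)) = (\<Sum>i\<in>I. lam i *\<^sub>R v i) - (\<Sum>i\<in>I. lam i *\<^sub>R w i)"
    by (simp add: scaleR_right_diff_distrib sum_subtractf)
  have 2: "(\<Sum>i\<in>I. lam i * ((1 - l) * (norm (v i))\<^sup>2 + l * (norm (w i))\<^sup>2
        - l * (1 - l) * (norm (v i - w i))\<^sup>2))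
    = (1 - l) * (\<Sum>i\<in>I. lam i * (norm (v i))\<^sup>2) + l * (\<Sum>i\<in>I. lam i * (norm (w i))\<^sup>2)
      - l * (1 - l) * (\<Sum>i\<in>I. lam i * (norm (v i - w i))\<^sup>2)"
    by (simp add: sum_distrib_left sum.distrib[symmetric] sum_subtractf[symmetric] algebra_simps)
  show ?thesis
    unfolding weighted_variance_def norm_convex_combination_sq sum_scaleR_convex_combination 1 2
    by (simp add: algebra_simps)
qed

section \<open>Linear lower bounds and moduli of smoothness\<close>

text \<open>
  Lower semicontinuity bounds \<open>f\<close> below on a ball around a point \<open>x\<^sub>0\<close> of its domain. At a point
  outside the ball, convexity along the segment to \<open>x\<^sub>0\<close> turns this into a bound that is linear in
  the distance from \<open>x\<^sub>0\<close>.
\<close>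

lemma proper_lsc_convex_lower_bound:
  fixes f :: "'a::real_normed_vector \<Rightarrow> ereal"
  assumes "proper_fun f" "lsc_fun f" "convex_fun f"
  obtains C D where "\<And>x. ereal (- C * norm x - D) \<le> f x"
proof -
  obtain x0 where "f x0 < \<infinity>" "f x0 \<noteq> -\<infinity>"
    using assms(1) unfolding proper_fun_def by blast
  then obtain a where a: "f x0 = ereal a" by (cases "f x0") auto
  have "ereal (a - 1) < f x0" by (simp add: a)
  then have "\<forall>\<^sub>F y in nhds x0. ereal (a - 1) < f y"
    using assms(2) unfolding lsc_fun_def by blast
  then obtain d where d: "d > 0" "\<And>y. dist y x0 < d \<Longrightarrow> ereal (a - 1) < f y"
    unfolding eventually_nhds_metric by blast
  define C where "C = 2 / d"
  have C: "C > 0" using d by (simp add: C_def)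
  have key: "ereal (a - 1 - C * norm (x - x0)) \<le> f x" for x
  proof (cases "norm (x - x0) < d")
    case True
    then have "ereal (a - 1) < f x" using d(2) by (simp add: dist_norm)
    moreover have "ereal (a - 1 - C * norm (x - x0)) \<le> ereal (a - 1)" using C by simp
    ultimately show ?thesis by (meson le_less_trans less_imp_le)
  next
    case False
    define n where "n = norm (x - x0)"
    have n: "n \<ge> d" "n > 0" using False d(1) by (auto simp: n_def)
    \<comment> \<open>chosen so that the point \<open>y\<close> below is at distance \<open>d / 2\<close> from \<open>x0\<close>\<close>
    define t where "t = d / (2 * n)"
    have t: "0 < t" "t < 1" using n d(1) by (auto simp: t_def field_simps)
    define y where "y = (1 - t) *\<^sub>R x0 + t *\<^sub>R x"
    have "y - x0 = t *\<^sub>R (x - x0)" by (simp add: y_def algebra_simps)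
    then have "dist y x0 = t * n" using t by (simp add: dist_norm n_def)
    also have "\<dots> < d" using n d(1) by (simp add: t_def)
    finally have "ereal (a - 1) < f y" using d(2) by blast
    also have "f y \<le> ereal (1 - t) * f x0 + ereal t * f x"
      using assms(3) t unfolding convex_fun_def y_def by auto
    finally have *: "ereal (a - 1) < ereal (1 - t) * ereal a + ereal t * f x" by (simp add: a)
    have "f x \<noteq> -\<infinity>" using assms(1) by (simp add: proper_fun_def)
    show ?thesis
    proof (cases "f x")
      case (real b)
      have "a - 1 < (1 - t) * a + t * b" using * by (simp add: real)
      then have "t * (a - b) < 1" by (simp add: algebra_simps)
      then have "a - b < 1 / t" using t by (simp add: field_simps)
      also have "1 / t = C * n" using n d(1) by (simp add: t_def C_def)
      finally show ?thesis by (simp add: real n_def)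
    qed (use \<open>f x \<noteq> -\<infinity>\<close> in auto)
  qed
  show ?thesis
  proof (rule that)
    fix x
    have "C * norm (x - x0) \<le> C * (norm x + norm x0)"
      using C norm_triangle_ineq4 by (intro mult_left_mono) auto
    then have "ereal (- C * norm x - (C * norm x0 + 1 - a)) \<le> ereal (a - 1 - C * norm (x - x0))"
      by (simp add: algebra_simps)
    then show "ereal (- C * norm x - (C * norm x0 + 1 - a)) \<le> f x"
      using key order_trans by blast
  qed
qed

lemma tendsto_scaled_modulus:
  fixes \<psi> :: "real \<Rightarrow> ereal"
  assumes lim: "((\<lambda>t. \<psi> t / ereal t) \<longlongrightarrow> 0) (at_right 0)" and a: "a > 0"
  shows "((\<lambda>t. (ereal a * \<psi> (t / a) + ereal (K * t\<^sup>2)) / ereal t) \<longlongrightarrow> 0) (at_right 0)"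
proof -
  have "filterlim (\<lambda>t. t / a) (at_right 0) (at_right 0)"
    unfolding filterlim_at
  proof
    have "((\<lambda>t. t / a) \<longlongrightarrow> 0 / a) (at_right 0)"
      using a by (intro tendsto_intros) auto
    then show "((\<lambda>t. t / a) \<longlongrightarrow> 0) (at_right 0)" by simp
    show "\<forall>\<^sub>F x in at_right 0. x / a \<in> {0<..} \<and> x / a \<noteq> 0"
      using a by (auto simp: eventually_at_right_less intro: eventually_mono[OF eventually_at_right_less])
  qed
  from filterlim_compose[OF lim this]
  have 1: "((\<lambda>t. \<psi> (t / a) / ereal (t / a)) \<longlongrightarrow> 0) (at_right 0)" .
  have "((\<lambda>t::real. K * t) \<longlongrightarrow> K * 0) (at_right 0)" by (intro tendsto_intros)
  then have 2: "((\<lambda>t. ereal (K * t)) \<longlongrightarrow> ereal 0) (at_right 0)"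
    by (intro tendsto_ereal) simp
  have "((\<lambda>t. \<psi> (t / a) / ereal (t / a) + ereal (K * t)) \<longlongrightarrow> 0 + ereal 0) (at_right 0)"
    by (intro tendsto_add_ereal 1 2) auto
  then have 3: "((\<lambda>t. \<psi> (t / a) / ereal (t / a) + ereal (K * t)) \<longlongrightarrow> 0) (at_right 0)"
    by (simp add: zero_ereal_def[symmetric])
  have "(ereal a * \<psi> (t / a) + ereal (K * t\<^sup>2)) / ereal t
      = \<psi> (t / a) / ereal (t / a) + ereal (K * t)" if "t > 0" for t
    using that a by (cases "\<psi> (t / a)") (auto simp: field_simps power2_eq_square)
  then have "\<forall>\<^sub>F t in at_right 0. \<psi> (t / a) / ereal (t / a) + ereal (K * t)
      = (ereal a * \<psi> (t / a) + ereal (K * t\<^sup>2)) / ereal t"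
    by (intro eventually_mono[OF eventually_at_right_less]) simp
  from Lim_transform_eventually[OF 3 this] show ?thesis .
qed

section \<open>The proximal average\<close>

lemma sum_fun_upd_scaleR:
  fixes v :: "'i \<Rightarrow> 'a::real_vector"
  assumes "finite I" "k \<in> I"
  shows "(\<Sum>i\<in>I. lam i *\<^sub>R (v(k := w)) i) = (\<Sum>i\<in>I. lam i *\<^sub>R v i) + lam k *\<^sub>R (w - v k)"
  using assms by (simp add: sum.remove[of I k] algebra_simps)

lemma sum_fun_upd_mult:
  fixes c :: "'i \<Rightarrow> real"
  assumes "finite I" "k \<in> I"
  shows "(\<Sum>i\<in>I. lam i * (c(k := b)) i) = (\<Sum>i\<in>I. lam i * c i) + lam k * (b - c k)"
  using assms by (simp add: sum.remove[of I k] algebra_simps)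

context
  fixes I :: "'i set" and \<mu> :: real and lam :: "'i \<Rightarrow> real"
    and f :: "'i \<Rightarrow> 'a::real_inner \<Rightarrow> ereal"
  assumes finI: "finite I" and mu: "\<mu> > 0"
    and lam: "\<And>i. i \<in> I \<Longrightarrow> lam i > 0" and lam1: "(\<Sum>i\<in>I. lam i) = 1"
    and f_proper: "\<And>i. i \<in> I \<Longrightarrow> proper_fun (f i)"
begin

lemma f_ne_MInf: "i \<in> I \<Longrightarrow> f i x \<noteq> -\<infinity>"
  using f_proper by (auto simp: proper_fun_def)

text \<open>
  The numbers \<open>c i\<close> need only dominate the values \<open>f i (v i)\<close>. In this form the description is used
  both to extract a nearly optimal family and to bound the average by a given one.
\<close>

lemma prox_average_less_iff:
  "prox_average I \<mu> f lam x < ereal r \<longleftrightarrow>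
    (\<exists>v c. (\<Sum>i\<in>I. lam i *\<^sub>R v i) = x \<and> (\<forall>i\<in>I. f i (v i) \<le> ereal (c i)) \<and>
       (\<Sum>i\<in>I. lam i * c i) + weighted_variance I lam v / (2 * \<mu>) < r)"
    (is "?L \<longleftrightarrow> ?R")
proof -
  define F where "F u = (\<Sum>i\<in>I. ereal (lam i) *
     (ereal \<mu> * f i (u i /\<^sub>R lam i) + ereal (1/2 * (norm (u i /\<^sub>R lam i))\<^sup>2)))" for u
  define s where "s = \<mu> * r + (norm x)\<^sup>2 / 2"
  have L: "?L \<longleftrightarrow> (\<exists>u. (\<Sum>i\<in>I. u i) = x \<and> F u < ereal s)"
  proof -
    have "ereal (1 / \<mu>) * (- ereal (1/2 * (norm x)\<^sup>2) + m) < ereal r \<longleftrightarrow> m < ereal s" for m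
      using mu by (cases m) (auto simp: s_def field_simps)
    then show ?thesis
      unfolding prox_average_def F_def by (auto simp: INF_less_iff)
  qed
  have F_real: "F u = ereal (\<mu> * (\<Sum>i\<in>I. lam i * c i) + (\<Sum>i\<in>I. lam i * (norm (u i /\<^sub>R lam i))\<^sup>2) / 2)"
    if "\<forall>i\<in>I. f i (u i /\<^sub>R lam i) = ereal (c i)" for u c
    unfolding F_def using that
    by (simp add: sum_distrib_left sum_divide_distrib sum.distrib algebra_simps)
  show ?thesis
  proof
    assume ?L
    then obtain u where u: "(\<Sum>i\<in>I. u i) = x" "F u < ereal s" using L by blast
    define v where "v i = u i /\<^sub>R lam i" for i
    have fin: "\<bar>f i (v i)\<bar> \<noteq> \<infinity>" if i: "i \<in> I" for i
    proof -
      have "F u \<noteq> \<infinity>" using u(2) by auto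
      then have "ereal (lam i) * (ereal \<mu> * f i (v i) + ereal (1/2 * (norm (v i))\<^sup>2)) \<noteq> \<infinity>"
        using i finI unfolding F_def v_def by (auto simp: sum_Pinfty)
      then show ?thesis
        using f_ne_MInf[OF i, of "v i"] lam[OF i] mu by (cases "f i (v i)") auto
    qed
    define c where "c i = real_of_ereal (f i (v i))" for i
    have c: "\<forall>i\<in>I. f i (v i) = ereal (c i)"
      using fin by (auto simp: c_def ereal_real')
    have v: "(\<Sum>i\<in>I. lam i *\<^sub>R v i) = x"
      unfolding u(1)[symmetric] by (rule sum.cong) (use lam in \<open>force simp: v_def\<close>)+
    have "\<mu> * (\<Sum>i\<in>I. lam i * c i) + (\<Sum>i\<in>I. lam i * (norm (v i))\<^sup>2) / 2 < s"
      using u(2) F_real[of u c] c by (simp add: v_def)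
    then have "(\<Sum>i\<in>I. lam i * c i) + weighted_variance I lam v / (2 * \<mu>) < r"
      using mu unfolding weighted_variance_def v s_def by (simp add: field_simps)
    with v c show ?R by (metis order_refl)
  next
    assume ?R
    then obtain v c where v: "(\<Sum>i\<in>I. lam i *\<^sub>R v i) = x"
      and c: "\<forall>i\<in>I. f i (v i) \<le> ereal (c i)"
      and r: "(\<Sum>i\<in>I. lam i * c i) + weighted_variance I lam v / (2 * \<mu>) < r" by blast
    define d where "d i = real_of_ereal (f i (v i))" for i
    have d: "f i (v i) = ereal (d i)" "d i \<le> c i" if "i \<in> I" for i
      using f_ne_MInf[OF that, of "v i"] c[rule_format, OF that] unfolding d_def
      by (cases "f i (v i)"; simp)+
    define u where "u i = lam i *\<^sub>R v i" for i
    have uv: "u i /\<^sub>R lam i = v i" if "i \<in> I" for i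
      using lam[OF that] by (simp add: u_def)
    have "(\<Sum>i\<in>I. lam i * d i) \<le> (\<Sum>i\<in>I. lam i * c i)"
      by (intro sum_mono mult_left_mono) (auto simp: d lam less_imp_le)
    with r have "(\<Sum>i\<in>I. lam i * d i) + weighted_variance I lam v / (2 * \<mu>) < r" by simp
    then have "\<mu> * (\<Sum>i\<in>I. lam i * d i) + (\<Sum>i\<in>I. lam i * (norm (v i))\<^sup>2) / 2 < s"
      using mu unfolding weighted_variance_def v s_def by (simp add: field_simps)
    then have "F u < ereal s"
      using F_real[of u d] d uv by simp
    moreover have "(\<Sum>i\<in>I. u i) = x" using v by (simp add: u_def)
    ultimately show ?L using L by blast
  qed
qed

lemma prox_average_le:
  assumes "(\<Sum>i\<in>I. lam i *\<^sub>R v i) = x" "\<And>i. i \<in> I \<Longrightarrow> f i (v i) \<le> ereal (c i)"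
  shows "prox_average I \<mu> f lam x
    \<le> ereal ((\<Sum>i\<in>I. lam i * c i) + weighted_variance I lam v / (2 * \<mu>))"
    (is "_ \<le> ereal ?s")
proof (rule ereal_le_epsilon2)
  fix e :: real assume "0 < e"
  then have "prox_average I \<mu> f lam x < ereal (?s + e)"
    unfolding prox_average_less_iff using assms by (intro exI[of _ v] exI[of _ c]) auto
  then show "prox_average I \<mu> f lam x \<le> ereal ?s + ereal e" by simp
qed

lemma proper_prox_average:
  assumes "\<And>i. i \<in> I \<Longrightarrow> lsc_fun (f i)" "\<And>i. i \<in> I \<Longrightarrow> convex_fun (f i)"
  shows "proper_fun (prox_average I \<mu> f lam)"
  unfolding proper_fun_def
proof (intro conjI allI)
  have "\<forall>i\<in>I. \<exists>C D. \<forall>x. ereal (- C * norm x - D) \<le> f i x"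
    using proper_lsc_convex_lower_bound f_proper assms by metis
  then obtain C D where CD: "\<And>i x. i \<in> I \<Longrightarrow> ereal (- C i * norm x - D i) \<le> f i x"
    by metis
  fix x :: 'a
  \<comment> \<open>The lower bound for the average at \<open>x\<close>. Its last term is the minimum over \<open>s\<close> of
    \<open>s\<^sup>2 / (2\<mu>) - \<bar>C i\<bar> s\<close>, where \<open>s\<close> stands for the distance of the \<open>i\<close>-th member of a family from \<open>x\<close>.\<close>
  define B where "B = (\<Sum>i\<in>I. lam i * (- \<bar>C i\<bar> * norm x - D i - \<mu> * (C i)\<^sup>2 / 2))"
  have "\<not> prox_average I \<mu> f lam x < ereal B"
  proof
    assume "prox_average I \<mu> f lam x < ereal B"
    then obtain v c where v: "(\<Sum>i\<in>I. lam i *\<^sub>R v i) = x"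
      and c: "\<forall>i\<in>I. f i (v i) \<le> ereal (c i)"
      and r: "(\<Sum>i\<in>I. lam i * c i) + weighted_variance I lam v / (2 * \<mu>) < B"
      unfolding prox_average_less_iff by blast
    have "B \<le> (\<Sum>i\<in>I. lam i * (c i + (norm (v i - x))\<^sup>2 / (2 * \<mu>)))"
      unfolding B_def
    proof (intro sum_mono mult_left_mono)
      fix i assume i: "i \<in> I"
      have "ereal (- C i * norm (v i) - D i) \<le> ereal (c i)"
        using CD[OF i] c i order_trans by blast
      then have 1: "- C i * norm (v i) - D i \<le> c i" by simp
      have "C i * norm (v i) \<le> \<bar>C i\<bar> * norm (v i)" by (simp add: mult_right_mono)
      also have "\<dots> \<le> \<bar>C i\<bar> * (norm x + norm (v i - x))"
        by (intro mult_left_mono) (auto simp: norm_triangle_sub)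
      finally have 2: "C i * norm (v i) \<le> \<bar>C i\<bar> * norm x + \<bar>C i\<bar> * norm (v i - x)"
        by (simp add: algebra_simps)
      have "0 \<le> (norm (v i - x) - \<mu> * \<bar>C i\<bar>)\<^sup>2 / (2 * \<mu>)" using mu by simp
      also have "\<dots> = (norm (v i - x))\<^sup>2 / (2 * \<mu>) - \<bar>C i\<bar> * norm (v i - x) + \<mu> * (C i)\<^sup>2 / 2"
        using mu by (simp add: power2_diff field_simps power2_eq_square)
      finally show "- \<bar>C i\<bar> * norm x - D i - \<mu> * (C i)\<^sup>2 / 2 \<le> c i + (norm (v i - x))\<^sup>2 / (2 * \<mu>)"
        using 1 2 by linarith
    qed (use lam in \<open>auto simp: less_imp_le\<close>)
    also have "\<dots> = (\<Sum>i\<in>I. lam i * c i) + weighted_variance I lam v / (2 * \<mu>)"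
      unfolding weighted_variance_eq_sum_dist[OF lam1] v
      by (simp add: sum.distrib sum_divide_distrib distrib_left)
    finally show False using r by simp
  qed
  then show "prox_average I \<mu> f lam x \<noteq> -\<infinity>" by auto
next
  have "\<forall>i\<in>I. \<exists>v c. f i v \<le> ereal c"
  proof
    fix i assume "i \<in> I"
    then obtain x where "f i x < \<infinity>" using f_proper by (auto simp: proper_fun_def)
    then have "f i x \<le> ereal (real_of_ereal (f i x))" by (cases "f i x") auto
    then show "\<exists>v c. f i v \<le> ereal c" by blast
  qed
  then obtain v c where "\<And>i. i \<in> I \<Longrightarrow> f i (v i) \<le> ereal (c i)" by metis
  from prox_average_le[OF refl this] show "\<exists>x. prox_average I \<mu> f lam x < \<infinity>"
    by (meson le_less_trans less_ereal.simps(4) ereal_less(4) ereal_less_PInfty)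
qed

lemma convex_prox_average:
  assumes conv: "\<And>i. i \<in> I \<Longrightarrow> convex_fun (f i)"
    and p_proper: "proper_fun (prox_average I \<mu> f lam)"
  shows "convex_fun (prox_average I \<mu> f lam)"
  unfolding convex_fun_def
proof (intro allI ballI)
  fix x y :: 'a and l :: real
  assume "l \<in> {0<..<1}"
  then have l: "0 < l" "l < 1" by auto
  let ?p = "prox_average I \<mu> f lam"
  let ?z = "(1 - l) *\<^sub>R x + l *\<^sub>R y"
  have ninf: "?p x \<noteq> -\<infinity>" "?p y \<noteq> -\<infinity>" using p_proper by (auto simp: proper_fun_def)
  show "?p ?z \<le> ereal (1 - l) * ?p x + ereal l * ?p y"
  proof (cases "?p x = \<infinity> \<or> ?p y = \<infinity>")
    case True
    then show ?thesis using l ninf by (cases "?p x"; cases "?p y") auto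
  next
    case False
    then obtain a b where a: "?p x = ereal a" and b: "?p y = ereal b"
      using ninf by (cases "?p x"; cases "?p y") auto
    have "?p ?z \<le> ereal ((1 - l) * a + l * b)"
    proof (rule ereal_le_epsilon2)
      fix e :: real assume e: "0 < e"
      have "?p x < ereal (a + e)" "?p y < ereal (b + e)" using e by (auto simp: a b)
      then obtain v c w d where
        v: "(\<Sum>i\<in>I. lam i *\<^sub>R v i) = x" "\<forall>i\<in>I. f i (v i) \<le> ereal (c i)"
          "(\<Sum>i\<in>I. lam i * c i) + weighted_variance I lam v / (2 * \<mu>) < a + e" and
        w: "(\<Sum>i\<in>I. lam i *\<^sub>R w i) = y" "\<forall>i\<in>I. f i (w i) \<le> ereal (d i)"
          "(\<Sum>i\<in>I. lam i * d i) + weighted_variance I lam w / (2 * \<mu>) < b + e"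
        unfolding prox_average_less_iff by blast
      define u where "u i = (1 - l) *\<^sub>R v i + l *\<^sub>R w i" for i
      define h where "h i = (1 - l) * c i + l * d i" for i
      have u: "(\<Sum>i\<in>I. lam i *\<^sub>R u i) = ?z"
        unfolding u_def sum_scaleR_convex_combination v(1) w(1) ..
      have h: "f i (u i) \<le> ereal (h i)" if i: "i \<in> I" for i
      proof -
        have "f i (u i) \<le> ereal (1 - l) * f i (v i) + ereal l * f i (w i)"
          using conv[OF i] l unfolding convex_fun_def u_def by auto
        also have "\<dots> \<le> ereal (1 - l) * ereal (c i) + ereal l * ereal (d i)"
          using l v(2) w(2) i by (intro add_mono ereal_mult_left_mono) auto
        finally show ?thesis by (simp add: h_def)
      qed
      have "weighted_variance I lam u
          \<le> (1 - l) * weighted_variance I lam v + l * weighted_variance I lam w"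
        unfolding u_def weighted_variance_convex_combination
        using l weighted_variance_nonneg[OF lam1 lam, of "\<lambda>i. v i - w i"] by simp
      then have "weighted_variance I lam u / (2 * \<mu>)
          \<le> ((1 - l) * weighted_variance I lam v + l * weighted_variance I lam w) / (2 * \<mu>)"
        using mu by (intro divide_right_mono) auto
      moreover have "(\<Sum>i\<in>I. lam i * h i)
          = (1 - l) * (\<Sum>i\<in>I. lam i * c i) + l * (\<Sum>i\<in>I. lam i * d i)"
        by (simp add: h_def sum_distrib_left sum.distrib[symmetric] algebra_simps)
      ultimately have "(\<Sum>i\<in>I. lam i * h i) + weighted_variance I lam u / (2 * \<mu>)
          \<le> (1 - l) * ((\<Sum>i\<in>I. lam i * c i) + weighted_variance I lam v / (2 * \<mu>))
             + l * ((\<Sum>i\<in>I. lam i * d i) + weighted_variance I lam w / (2 * \<mu>))"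
        by (simp add: distrib_left add_divide_distrib)
      also have "\<dots> \<le> (1 - l) * (a + e) + l * (b + e)"
        using l less_imp_le[OF v(3)] less_imp_le[OF w(3)]
        by (intro add_mono[OF mult_left_mono mult_left_mono]) auto
      also have "\<dots> = (1 - l) * a + l * b + e" by (simp add: algebra_simps)
      finally show "?p ?z \<le> ereal ((1 - l) * a + l * b) + ereal e"
        using prox_average_le[OF u h] order_trans by fastforce
    qed
    then show ?thesis by (simp add: a b)
  qed
qed

text \<open>
  One smooth member suffices, whatever the other functions are: only the \<open>k\<close>-th member of a
  nearly optimal family is moved.
\<close>

lemma prox_average_smoothness_inequality:
  assumes k: "k \<in> I"
    and p_proper: "proper_fun (prox_average I \<mu> f lam)"
    and smooth: "\<And>x y l. l \<in> {0<..<1} \<Longrightarrow> f k ((1 - l) *\<^sub>R x + l *\<^sub>R y) < \<infinity> \<Longrightarrow>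
        ereal (1 - l) * f k x + ereal l * f k y
        \<le> f k ((1 - l) *\<^sub>R x + l *\<^sub>R y) + ereal (l * (1 - l)) * \<psi> (norm (x - y))"
    and psi: "\<And>t. 0 \<le> t \<Longrightarrow> 0 \<le> \<psi> t"
    and l: "0 < l" "l < 1"
    and dom: "prox_average I \<mu> f lam ((1 - l) *\<^sub>R x + l *\<^sub>R y) < \<infinity>"
  shows "ereal (1 - l) * prox_average I \<mu> f lam x + ereal l * prox_average I \<mu> f lam y
    \<le> prox_average I \<mu> f lam ((1 - l) *\<^sub>R x + l *\<^sub>R y) + ereal (l * (1 - l)) *
        (ereal (lam k) * \<psi> (norm (x - y) / lam k)
          + ereal ((1 / lam k - 1) / (2 * \<mu>) * (norm (x - y))\<^sup>2))"
proof -
  let ?p = "prox_average I \<mu> f lam"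
  define z where "z = (1 - l) *\<^sub>R x + l *\<^sub>R y"
  define K where "K = (1 / lam k - 1) / (2 * \<mu>)"
  have lk: "lam k > 0" using lam k by blast
  have ll: "l * (1 - l) > 0" using l by simp
  have "?p z \<noteq> -\<infinity>" using p_proper by (auto simp: proper_fun_def)
  with dom obtain r where r: "?p z = ereal r" by (cases "?p z") (auto simp: z_def)
  have psi0: "0 \<le> \<psi> (norm (x - y) / lam k)" using psi lk by simp
  show ?thesis
  proof (cases "\<psi> (norm (x - y) / lam k)")
    case PInf
    then show ?thesis using lk ll l r by (auto simp: z_def[symmetric])
  next
    case MInf
    then show ?thesis using psi0 by simp
  next
    case (real w)
    define W where "W = lam k * w + K * (norm (x - y))\<^sup>2"
    have "ereal (1 - l) * ?p x + ereal l * ?p y \<le> ereal (r + l * (1 - l) * W)"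
    proof (rule ereal_le_epsilon2)
      fix e :: real assume "0 < e"
      then have "?p z < ereal (r + e)" by (simp add: r)
      then obtain v c where v: "(\<Sum>i\<in>I. lam i *\<^sub>R v i) = z"
        and c: "\<forall>i\<in>I. f i (v i) \<le> ereal (c i)"
        and re: "(\<Sum>i\<in>I. lam i * c i) + weighted_variance I lam v / (2 * \<mu>) < r + e"
        unfolding prox_average_less_iff by blast
      define xk where "xk = v k + (x - z) /\<^sub>R lam k"
      define yk where "yk = v k + (y - z) /\<^sub>R lam k"
      define vx where "vx = v(k := xk)"
      define vy where "vy = v(k := yk)"
      have vk: "(1 - l) *\<^sub>R xk + l *\<^sub>R yk = v k"
      proof -
        have "(1 - l) *\<^sub>R xk + l *\<^sub>R yk = v k + ((1 - l) *\<^sub>R (x - z) + l *\<^sub>R (y - z)) /\<^sub>R lam k"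
          by (simp add: xk_def yk_def algebra_simps)
        also have "(1 - l) *\<^sub>R (x - z) + l *\<^sub>R (y - z) = 0"
          by (simp add: z_def algebra_simps)
        finally show ?thesis by simp
      qed
      have xyk: "xk - yk = (x - y) /\<^sub>R lam k"
        by (simp add: xk_def yk_def algebra_simps)
      have nxyk: "norm (xk - yk) = norm (x - y) / lam k"
        using lk by (simp add: xyk divide_inverse)
      have sx: "(\<Sum>i\<in>I. lam i *\<^sub>R vx i) = x" and sy: "(\<Sum>i\<in>I. lam i *\<^sub>R vy i) = y"
        unfolding vx_def vy_def sum_fun_upd_scaleR[OF finI k] v using lk
        by (simp_all add: xk_def yk_def)
      have fk: "f k (v k) \<le> ereal (c k)" using c k by blast
      then have fin: "f k (v k) < \<infinity>" by (rule le_less_trans) simp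
      have "ereal (1 - l) * f k xk + ereal l * f k yk
          \<le> f k (v k) + ereal (l * (1 - l)) * \<psi> (norm (xk - yk))"
        using smooth[of l xk yk] l fin unfolding vk by simp
      also have "\<dots> \<le> ereal (c k) + ereal (l * (1 - l)) * ereal w"
        using fk unfolding nxyk real by (intro add_mono) auto
      finally have sm: "ereal (1 - l) * f k xk + ereal l * f k yk \<le> ereal (c k + l * (1 - l) * w)"
        by simp
      moreover have "f k xk \<noteq> -\<infinity>" "f k yk \<noteq> -\<infinity>" using f_ne_MInf[OF k] by auto
      ultimately obtain a b where a: "f k xk = ereal a" and b: "f k yk = ereal b"
        using l by (cases "f k xk"; cases "f k yk") auto
      have ab: "(1 - l) * a + l * b \<le> c k + l * (1 - l) * w"
        using sm by (simp add: a b)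
      define cx where "cx = c(k := a)"
      define cy where "cy = c(k := b)"
      have px: "?p x \<le> ereal ((\<Sum>i\<in>I. lam i * cx i) + weighted_variance I lam vx / (2 * \<mu>))"
        by (rule prox_average_le[OF sx]) (use c a in \<open>auto simp: vx_def cx_def\<close>)
      have py: "?p y \<le> ereal ((\<Sum>i\<in>I. lam i * cy i) + weighted_variance I lam vy / (2 * \<mu>))"
        by (rule prox_average_le[OF sy]) (use c b in \<open>auto simp: vy_def cy_def\<close>)
      have vdiff: "weighted_variance I lam (\<lambda>i. vx i - vy i) = (1 / lam k - 1) * (norm (x - y))\<^sup>2"
      proof -
        have "(\<Sum>i\<in>I. lam i * (norm (vx i - vy i))\<^sup>2) = lam k * (norm (xk - yk))\<^sup>2"
          using finI k by (simp add: sum.remove[of I k] vx_def vy_def)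
        also have "\<dots> = 1 / lam k * (norm (x - y))\<^sup>2"
          unfolding nxyk using lk by (simp add: power_divide power2_eq_square)
        finally have 1: "(\<Sum>i\<in>I. lam i * (norm (vx i - vy i))\<^sup>2) = 1 / lam k * (norm (x - y))\<^sup>2" .
        have 2: "(\<Sum>i\<in>I. lam i *\<^sub>R (vx i - vy i)) = x - y"
          by (simp add: scaleR_right_diff_distrib sum_subtractf sx sy)
        show ?thesis unfolding weighted_variance_def 1 2 by (simp add: algebra_simps)
      qed
      have "(\<lambda>i. (1 - l) *\<^sub>R vx i + l *\<^sub>R vy i) = v"
        using vk by (auto simp: vx_def vy_def fun_eq_iff algebra_simps)
      then have "(1 - l) * weighted_variance I lam vx + l * weighted_variance I lam vy
          = weighted_variance I lam v + l * (1 - l) * ((1 / lam k - 1) * (norm (x - y))\<^sup>2)"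
        using weighted_variance_convex_combination[of I lam l vx vy] vdiff by simp
      then have var: "((1 - l) * weighted_variance I lam vx + l * weighted_variance I lam vy) / (2 * \<mu>)
          = weighted_variance I lam v / (2 * \<mu>) + l * (1 - l) * (K * (norm (x - y))\<^sup>2)"
        by (simp add: add_divide_distrib K_def)
      have "(1 - l) * (\<Sum>i\<in>I. lam i * cx i) + l * (\<Sum>i\<in>I. lam i * cy i)
          = (\<Sum>i\<in>I. lam i * c i) + lam k * ((1 - l) * a + l * b - c k)"
        unfolding cx_def cy_def sum_fun_upd_mult[OF finI k] by (simp add: algebra_simps)
      also have "\<dots> \<le> (\<Sum>i\<in>I. lam i * c i) + lam k * (l * (1 - l) * w)"
        using lk ab by (intro add_left_mono mult_left_mono) auto
      finally have cc: "(1 - l) * (\<Sum>i\<in>I. lam i * cx i) + l * (\<Sum>i\<in>I. lam i * cy i)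
          \<le> (\<Sum>i\<in>I. lam i * c i) + l * (1 - l) * (lam k * w)" by (simp add: mult_ac)
      have "ereal (1 - l) * ?p x + ereal l * ?p y
        \<le> ereal (1 - l) * ereal ((\<Sum>i\<in>I. lam i * cx i) + weighted_variance I lam vx / (2 * \<mu>))
          + ereal l * ereal ((\<Sum>i\<in>I. lam i * cy i) + weighted_variance I lam vy / (2 * \<mu>))"
        using l px py by (intro add_mono ereal_mult_left_mono) auto
      also have "\<dots> = ereal ((1 - l) * (\<Sum>i\<in>I. lam i * cx i) + l * (\<Sum>i\<in>I. lam i * cy i)
          + ((1 - l) * weighted_variance I lam vx + l * weighted_variance I lam vy) / (2 * \<mu>))"
        by (simp add: distrib_left add_divide_distrib)
      also have "\<dots> \<le> ereal (r + l * (1 - l) * W + e)"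
        using cc re unfolding var W_def by (simp add: distrib_left)
      finally show "ereal (1 - l) * ?p x + ereal l * ?p y \<le> ereal (r + l * (1 - l) * W) + ereal e"
        by simp
    qed
    then show ?thesis
      unfolding z_def[symmetric] r real K_def[symmetric] by (simp add: W_def)
  qed
qed

end

section \<open>Uniform smoothness\<close>

theorem theorem3p16:
  fixes f :: "nat \<Rightarrow> 'a::{real_inner, complete_space} \<Rightarrow> ereal"
    and lam :: "nat \<Rightarrow> real" and \<mu> :: real and n :: nat
  assumes "\<mu> > 0"
    and "n \<ge> 1"
    and "\<And>i. i \<in> {1..n} \<Longrightarrow> lam i > 0"
    and "(\<Sum>i\<in>{1..n}. lam i) = 1"
    and "\<And>i. i \<in> {1..n} \<Longrightarrow> proper_fun (f i)"
    and "\<And>i. i \<in> {1..n} \<Longrightarrow> lsc_fun (f i)"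
    and "\<And>i. i \<in> {1..n} \<Longrightarrow> convex_fun (f i)"
    and "\<exists>i0\<in>{1..n}. uniformly_smooth (f i0)"
  shows "uniformly_smooth (prox_average {1..n} \<mu> f lam)"
proof -
  let ?I = "{1..n}"
  note hyps = finite_atLeastAtMost[of 1 n] assms(1) assms(3) assms(4) assms(5)
  have p_proper: "proper_fun (prox_average ?I \<mu> f lam)"
    by (rule proper_prox_average) (use assms in auto)
  have cv: "convex_fun (prox_average ?I \<mu> f lam)"
    by (rule convex_prox_average) (use assms p_proper in auto)
  obtain k \<psi> where k: "k \<in> ?I" and psi: "\<forall>t\<ge>0. 0 \<le> \<psi> t"
    and lim: "((\<lambda>t. \<psi> t / ereal t) \<longlongrightarrow> 0) (at_right 0)"
    and smooth: "\<And>x y l. l \<in> {0<..<1} \<Longrightarrow> f k ((1 - l) *\<^sub>R x + l *\<^sub>R y) < \<infinity> \<Longrightarrow>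
        ereal (1 - l) * f k x + ereal l * f k y
        \<le> f k ((1 - l) *\<^sub>R x + l *\<^sub>R y) + ereal (l * (1 - l)) * \<psi> (norm (x - y))"
    using assms(8) unfolding uniformly_smooth_def by blast
  have lk: "0 < lam k" using assms(3) k by blast
  have "lam k \<le> (\<Sum>i\<in>?I. lam i)"
    using k assms(3) by (intro member_le_sum) (auto simp: less_imp_le)
  then have lk1: "lam k \<le> 1" using assms(4) by simp
  define K where "K = (1 / lam k - 1) / (2 * \<mu>)"
  have K: "K \<ge> 0" using lk lk1 assms(1) by (simp add: K_def)
  define \<phi> where "\<phi> t = ereal (lam k) * \<psi> (t / lam k) + ereal (K * t\<^sup>2)" for t
  have "0 \<le> \<phi> t" if "0 \<le> t" for t
    unfolding \<phi>_def using that psi lk K by (intro add_nonneg_nonneg) auto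
  moreover have "((\<lambda>t. \<phi> t / ereal t) \<longlongrightarrow> 0) (at_right 0)"
    unfolding \<phi>_def by (rule tendsto_scaled_modulus[OF lim lk])
  moreover have "ereal (1 - l) * prox_average ?I \<mu> f lam x + ereal l * prox_average ?I \<mu> f lam y
      \<le> prox_average ?I \<mu> f lam ((1 - l) *\<^sub>R x + l *\<^sub>R y) + ereal (l * (1 - l)) * \<phi> (norm (x - y))"
    if "l \<in> {0<..<1}" "prox_average ?I \<mu> f lam ((1 - l) *\<^sub>R x + l *\<^sub>R y) < \<infinity>" for x y l
    unfolding \<phi>_def K_def
    by (rule prox_average_smoothness_inequality[where \<psi> = \<psi>, OF hyps k p_proper smooth])
       (use that psi in auto)
  ultimately show ?thesis
    unfolding uniformly_smooth_def using p_proper cv by blast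
qed

end
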